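(* Let $n\ge 6$ be an integer, $q=2^n$, $a_1\in\mathbb{F}_q^{*}$, $a_2,b\in\mathbb{F}_{q^2}^{*}$ with $a_1\ne a_2$. For $i=1,2$ let $f_i(x)=\mathrm{Tr}_1^{2n}\!\left(\frac{a_i}{x^{q-1}+b}\right)$ for $x\in\mathbb{F}_{q^2}$, and let $h_2(x)=f_1(x)f_2(x)$. Then $h_2$ is bent if and only if one of the following conditions holds: (1) $b=1$, $\mathrm{Tr}_1^n(a_1)=1$ and $a_2\in\mathbb{F}_{q^2}^{*}\setminus\mathbb{F}_q^{*}$; (2) $b\in U\setminus\{1\}$, $\mathrm{Tr}_n^{2n}(a_2\overline{b})=0$, $\mathrm{Tr}_1^n(a_2\overline{a_2})=1$ and $h_2(0)=0$; (3) $b\in U\setminus\{1\}$, $\mathrm{Tr}_n^{2n}((a_1+a_2)\overline{b})=0$, $\mathrm{Tr}_1^n((a_1+a_2)(a_1+\overline{a_2}))=0$ and $h_2(0)=0$.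
   Context: For $k\mid m$, $\mathrm{Tr}_k^{m}(x)=x+x^{2^k}+\cdots+x^{2^{(m/k-1)k}}$ is the trace from $\mathbb{F}_{2^m}$ to $\mathbb{F}_{2^k}$. For $x\in\mathbb{F}_{q^2}$ write $\overline{x}=x^{q}$. The unit circle is $U=\{\eta\in\mathbb{F}_{q^2}:\eta^{q+1}=1\}$. Division by zero is interpreted with the convention $\frac{1}{0}=0$. A Boolean function $f:\mathbb{F}_{2^{m}}\to\mathbb{F}_2$ is bent if its Walsh transform $W_f(\omega)=\sum_{x\in\mathbb{F}_{2^m}}(-1)^{f(x)+\mathrm{Tr}_1^m(\omega x)}$ satisfies $W_f(\omega)^2=2^m$ for all $\omega\in\mathbb{F}_{2^m}$. *)

theory Defs
  imports Main
begin

text \<open>We model \<open>F_{q^2}\<close>, \<open>q = 2^n\<close>, as an arbitrary finite field type \<open>'a\<close>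
  with exactly \<open>2^(2n)\<close> elements (unique up to isomorphism).
  \<open>F_q\<close> is the subfield of elements fixed by \<open>x \<mapsto> x^q\<close>, and \<open>F_2 = {0,1}\<close>.\<close>

definition tr :: "nat \<Rightarrow> nat \<Rightarrow> 'a::field \<Rightarrow> 'a" where
  "tr k m x = (\<Sum>i<m div k. x ^ (2 ^ (k * i)))"

definition conj_q :: "nat \<Rightarrow> 'a::field \<Rightarrow> 'a" where
  "conj_q n x = x ^ (2 ^ n)"

definition subfield_q :: "nat \<Rightarrow> 'a::field set" where
  "subfield_q n = {x. x ^ (2 ^ n) = x}"

definition unit_circle :: "nat \<Rightarrow> 'a::field set" where
  "unit_circle n = {\<eta>. \<eta> ^ (2 ^ n + 1) = 1}"

text \<open>Walsh transform of a Boolean function \<open>f\<close> on \<open>F_{2^m}\<close> (the field \<open>'a\<close>, \<open>m\<close> its degree),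
  whose values lie in \<open>F_2 = {0,1} \<subseteq> 'a\<close>; \<open>(-1)^y\<close> for \<open>y \<in> F_2\<close> is \<open>1\<close> iff \<open>y = 0\<close>.\<close>
definition walsh :: "nat \<Rightarrow> ('a::{field,finite} \<Rightarrow> 'a) \<Rightarrow> 'a \<Rightarrow> int" where
  "walsh m f \<omega> = (\<Sum>x\<in>UNIV. if f x + tr 1 m (\<omega> * x) = 0 then 1 else -1)"

definition bent :: "nat \<Rightarrow> ('a::{field,finite} \<Rightarrow> 'a) \<Rightarrow> bool" where
  "bent m f \<longleftrightarrow> (\<forall>\<omega>. (walsh m f \<omega>)\<^sup>2 = 2 ^ m)"

text \<open>\<open>f_i(x) = Tr_1^{2n}(a_i / (x^{q-1} + b))\<close>, with Isabelle's convention \<open>y/0 = 0\<close>.\<close>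
definition fi :: "nat \<Rightarrow> 'a::field \<Rightarrow> 'a \<Rightarrow> 'a \<Rightarrow> 'a" where
  "fi n a b x = tr 1 (2 * n) (a / (x ^ (2 ^ n - 1) + b))"

end

theory Submission
  imports Defs "HOL-Computational_Algebra.Polynomial"
begin

text \<open>
  Writing a nonzero \<open>x\<close> as \<open>y * z\<close> with \<open>y\<close> in \<open>F_q\<close> and \<open>z\<close> in \<open>U\<close>, a function of
  \<open>x^(q-1)\<close> depends on \<open>z\<close> only, and its Walsh transform shows that it is bent iff
  the sum \<open>S\<close> of its signs over \<open>U\<close> equals its sign at \<open>0\<close>. For the product of two traces,
  \<open>2 S = q + 1 + P(a1) + P(a2) - P(a1 + a2)\<close>, where \<open>P(a)\<close> is the sum over \<open>\<eta>\<close> in \<open>U\<close> of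
  \<open>(-1)^Tr(a / (\<eta> + b))\<close>.

  If \<open>b\<close> is in \<open>U\<close>, inversion maps the circle to a line and \<open>P(a)\<close> is \<open>1\<close>, \<open>1 + q\<close>
  or \<open>1 - q\<close>; the three conditions express \<open>S = 1\<close>. If \<open>b\<close> is not in \<open>U\<close>, inversion maps the
  circle to a circle and \<open>P(a)\<close> is, up to sign, a Kloosterman-type sum \<open>T(u)\<close>, the sum of
  \<open>(-1)^Tr(u \<eta>)\<close> over \<open>U\<close>. Instead of Weil's bound, the second and fourth moments suffice:
  the sum of \<open>(T^2 - q)^2\<close> over the nonzero cosets of \<open>U\<close> is at most \<open>q^3 - q^2 - q - 1\<close>. This
  gives \<open>3 |T| < q - 1\<close> for \<open>n \<ge> 7\<close>. For \<open>n = 6\<close> it gives \<open>2 |T(u)| + |T(v)| < q - 1\<close> for two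
  distinct cosets, and \<open>u\<close>, \<open>v\<close>, \<open>u + v\<close> never lie in one coset when \<open>n\<close> is even. So \<open>S > 1\<close>.
\<close>

lemma sum_lessThan_add:
  fixes f :: "nat \<Rightarrow> 'b::comm_monoid_add"
  shows "(\<Sum>i<k + m. f i) = (\<Sum>i<k. f i) + (\<Sum>i<m. f (k + i))"
  by (induction m) (simp_all add: add.assoc)

text \<open>The sign \<open>(-1)^t\<close> as an integer, for \<open>t\<close> in F_2 inside the
  field; the encoding is that of \<open>walsh\<close>.\<close>

definition sgn2 :: "'a::zero \<Rightarrow> int" where
  "sgn2 t = (if t = 0 then 1 else -1)"

lemma sgn2_0 [simp]: "sgn2 0 = 1"
  by (simp add: sgn2_def)

lemma sgn2_cases: "sgn2 t = 1 \<or> sgn2 t = -1"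
  by (simp add: sgn2_def)

lemma abs_sgn2 [simp]: "\<bar>sgn2 t\<bar> = 1"
  by (simp add: sgn2_def)

locale binary_quadratic_extension =
  fixes n :: nat and field_type :: "'a::{field,finite} itself"
  assumes n_pos: "n > 0" and card_field: "card (UNIV :: 'a set) = 2 ^ (2 * n)"
begin

subsection \<open>The field and its subfield\<close>

text \<open>Translation by 1 permutes the field, so its cardinality, a power of two, is zero in
  it.\<close>

lemma two_eq_0: "(2 :: 'a) = 0"
proof -
  have "(\<Sum>x\<in>(UNIV :: 'a set). x + 1) = (\<Sum>x\<in>UNIV. x)"
    by (rule sum.reindex_bij_betw[of "\<lambda>x. x + 1"])
      (auto simp: bij_betw_def inj_on_def intro!: image_eqI[where x = "x - 1" for x])
  then have "of_nat (card (UNIV :: 'a set)) = (0 :: 'a)"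
    by (simp add: sum.distrib)
  then show ?thesis
    by (simp add: card_field)
qed

lemma add_self [simp]: "x + x = (0 :: 'a)"
  by (metis mult_2 mult_zero_left two_eq_0)

lemma add_self_left [simp]: "x + (x + y) = (y :: 'a)"
  by (simp flip: add.assoc)

lemma add_eq_0_iff_eq: "x + y = 0 \<longleftrightarrow> x = (y :: 'a)"
  by (metis add_self add.right_neutral add_self_left)

lemma power_2_power_add: "(x + y :: 'a) ^ 2 ^ k = x ^ 2 ^ k + y ^ 2 ^ k"
proof (induction k)
  case (Suc k)
  have sq: "(u + v) ^ 2 = u ^ 2 + v ^ 2" for u v :: 'a
    by (simp add: power2_sum two_eq_0)
  have "(x + y) ^ 2 ^ Suc k = ((x + y) ^ 2 ^ k) ^ 2"
    by (simp add: mult.commute flip: power_mult)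
  also have "\<dots> = (x ^ 2 ^ k) ^ 2 + (y ^ 2 ^ k) ^ 2"
    by (simp only: Suc sq)
  also have "\<dots> = x ^ 2 ^ Suc k + y ^ 2 ^ Suc k"
    by (simp add: mult.commute flip: power_mult)
  finally show ?case .
qed simp

lemma power_2_power_inject: "x ^ 2 ^ k = y ^ 2 ^ k \<Longrightarrow> x = (y :: 'a)"
  using power_2_power_add[of x y k] by (simp add: add_eq_0_iff_eq)

lemma power_2_power_sum: "(\<Sum>i\<in>A. f i :: 'a) ^ 2 ^ k = (\<Sum>i\<in>A. f i ^ 2 ^ k)"
  by (induction A rule: infinite_finite_induct) (simp_all add: power_2_power_add)

text \<open>Multiplication by \<open>x\<close> permutes the nonzero elements; compare their
  products.\<close>

lemma power_card_field: "x ^ 2 ^ (2 * n) = (x :: 'a)"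
proof (cases "x = 0")
  case False
  let ?U = "UNIV - {0 :: 'a}"
  have "(\<Prod>y\<in>?U. x * y) = (\<Prod>y\<in>?U. y)"
    by (rule prod.reindex_bij_betw[of "\<lambda>y. x * y"])
      (use False in \<open>auto simp: bij_betw_def inj_on_def intro!: image_eqI[where x = "y / x" for y]\<close>)
  moreover have "(\<Prod>y\<in>?U. y) \<noteq> 0"
    by simp
  ultimately have "x ^ card ?U = 1"
    by (simp add: prod.distrib)
  then have "x ^ Suc (card ?U) = x"
    by simp
  moreover have "Suc (card ?U) = 2 ^ (2 * n)"
    by (simp only: card_Suc_Diff1 finite_UNIV UNIV_I card_field)
  ultimately show ?thesis by metis
qed simp

section \<open>Conjugation and the unit circle\<close>

abbreviation cj :: "'a \<Rightarrow> 'a" where "cj \<equiv> conj_q n"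
abbreviation Fq :: "'a set" where "Fq \<equiv> subfield_q n"
abbreviation U :: "'a set" where "U \<equiv> unit_circle n"
abbreviation q :: int where "q \<equiv> 2 ^ n"

lemma cj_add: "cj (x + y) = cj x + cj y"
  by (simp add: conj_q_def power_2_power_add)

lemma cj_mult: "cj (x * y) = cj x * cj y"
  by (simp add: conj_q_def power_mult_distrib)

lemma cj_divide: "cj (x / y) = cj x / cj y"
  by (simp add: conj_q_def power_divide)

lemma cj_0 [simp]: "cj 0 = 0"
  by (simp add: conj_q_def)

lemma cj_1 [simp]: "cj 1 = 1"
  by (simp add: conj_q_def)

lemma cj_eq_0_iff [simp]: "cj x = 0 \<longleftrightarrow> x = 0"
  by (simp add: conj_q_def)

lemma cj_cj [simp]: "cj (cj x) = x"
  using power_card_field[of x] by (simp add: conj_q_def mult_2 power_add flip: power_mult)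

lemma mem_Fq_iff: "x \<in> Fq \<longleftrightarrow> cj x = x"
  by (simp add: subfield_q_def conj_q_def)

lemma mem_U_iff: "x \<in> U \<longleftrightarrow> x * cj x = 1"
  by (simp add: unit_circle_def conj_q_def)

lemma zero_notin_U [simp]: "0 \<notin> U"
  by (simp add: mem_U_iff)

lemma one_in_U [simp]: "1 \<in> U"
  by (simp add: mem_U_iff)

lemma cj_U: "x \<in> U \<Longrightarrow> cj x = inverse x"
  by (metis inverse_unique mem_U_iff)

lemma mult_in_U: "x \<in> U \<Longrightarrow> y \<in> U \<Longrightarrow> x * y \<in> U"
  by (simp add: mem_U_iff cj_mult) (metis mult.assoc mult.commute mult.left_neutral)

lemma inverse_in_U: "x \<in> U \<Longrightarrow> inverse x \<in> U"
  by (metis cj_U mem_U_iff cj_cj mult.commute)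

text \<open>On the intersection conjugation is both the identity and inversion, so
  \<open>x ^ 2 = 1\<close>, and squaring is injective.\<close>

lemma Fq_inter_U: "x \<in> Fq \<Longrightarrow> x \<in> U \<Longrightarrow> x = 1"
  using power_2_power_inject[of x 1 1]
  by (simp add: mem_Fq_iff mem_U_iff power2_eq_square)

lemma power_q_minus_1: "x \<in> U \<Longrightarrow> x ^ (2 ^ n - 1) = inverse (x ^ 2)"
proof -
  assume x: "x \<in> U"
  then have "x ^ (2 ^ n - 1) * x ^ 2 = x ^ (2 ^ n + 1)"
    by (simp flip: power_add)
  then have "x ^ 2 * x ^ (2 ^ n - 1) = 1"
    using x by (simp only: unit_circle_def mem_Collect_eq mult.commute[of "x ^ 2"])
  then show ?thesis
    by (rule inverse_unique[symmetric])
qed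

section \<open>Absolute and relative traces\<close>

lemma tr_1_add: "tr 1 m (x + y :: 'a) = tr 1 m x + tr 1 m y"
  by (simp add: tr_def power_2_power_add sum.distrib)

lemma tr_0 [simp]: "tr k m (0 :: 'a) = 0"
  by (simp add: tr_def power_0_left)

lemma tr_1_square:
  assumes "x ^ 2 ^ m = (x :: 'a)"
  shows "tr 1 m (x ^ 2) = tr 1 m x"
proof -
  have "tr 1 m (x ^ 2) = (\<Sum>i<m. x ^ 2 ^ Suc i)"
    by (simp add: tr_def flip: power_mult)
  \<comment> \<open>Adding \<open>x\<close> supplies the index 0 that the shift lost; the new top
    term \<open>x ^ 2 ^ m\<close> equals \<open>x\<close> and cancels it.\<close>
  also have "\<dots> + x = (\<Sum>i<Suc m. x ^ 2 ^ i)"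
    by (subst sum.lessThan_Suc_shift) (simp add: add.commute)
  also have "\<dots> = tr 1 m x + x"
    using assms by (simp add: tr_def)
  finally show ?thesis by simp
qed

lemma tr_1_cases:
  assumes "x ^ 2 ^ m = (x :: 'a)"
  shows "tr 1 m x = 0 \<or> tr 1 m x = 1"
proof -
  have "(tr 1 m x) ^ 2 = tr 1 m (x ^ 2)"
    using power_2_power_sum[of "\<lambda>i. x ^ 2 ^ i" "{..<m}" 1]
    by (simp add: tr_def mult.commute flip: power_mult)
  then have "tr 1 m x * (tr 1 m x - 1) = 0"
    using tr_1_square[OF assms] by (simp add: power2_eq_square algebra_simps)
  then show ?thesis
    by simp
qed

abbreviation Tr :: "'a \<Rightarrow> 'a" where "Tr \<equiv> tr 1 (2 * n)"

lemma Tr_cases: "Tr x = 0 \<or> Tr x = 1"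
  by (rule tr_1_cases) (rule power_card_field)

lemma tr_n: "tr n (2 * n) x = x + cj x"
proof -
  have "2 * n div n = Suc (Suc 0)"
    using n_pos by simp
  then show ?thesis
    by (simp add: tr_def conj_q_def)
qed

lemma tr_n_eq_0_iff: "tr n (2 * n) x = 0 \<longleftrightarrow> x \<in> Fq"
  by (auto simp: tr_n mem_Fq_iff add_eq_0_iff_eq)

lemma Tr_eq_tr_n: "Tr x = tr 1 n (x + cj x)"
proof -
  have "Tr x = (\<Sum>i<n + n. x ^ 2 ^ i)"
    by (simp add: tr_def mult_2)
  also have "\<dots> = tr 1 n x + tr 1 n (cj x)"
    by (simp add: sum_lessThan_add tr_def conj_q_def power_add flip: power_mult)
  finally show ?thesis
    by (simp only: tr_1_add)
qed

lemma Tr_Fq: "x \<in> Fq \<Longrightarrow> Tr x = 0"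
  by (simp only: Tr_eq_tr_n mem_Fq_iff add_self tr_0)

text \<open>Otherwise the trace polynomial, nonzero because of its linear coefficient and of degree
  at most \<open>2 ^ (2 * n - 1)\<close>, would vanish on the whole field.\<close>

lemma Tr_nontrivial: "\<exists>x. Tr x = 1"
proof (rule ccontr)
  assume "\<nexists>x. Tr x = 1"
  then have 0: "Tr x = 0" for x
    using Tr_cases by blast
  define p :: "'a poly" where "p = (\<Sum>i<2 * n. monom 1 (2 ^ i))"
  have "coeff p 1 = (\<Sum>i<2 * n. if i = 0 then 1 else 0)"
    unfolding p_def coeff_sum by (intro sum.cong) auto
  then have "coeff p 1 = 1"
    using n_pos by simp
  then have "p \<noteq> 0"
    by auto
  then have "card {x. poly p x = 0} \<le> degree p"
    by (rule card_poly_roots_bound)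
  moreover have "poly p x = 0" for x
    using 0[of x] by (simp add: p_def poly_sum poly_monom tr_def)
  moreover have "degree p \<le> 2 ^ (2 * n - 1)"
    unfolding p_def by (intro degree_sum_le) (auto intro!: order.trans[OF degree_monom_le])
  ultimately have "2 ^ (2 * n) \<le> (2 :: nat) ^ (2 * n - 1)"
    by (metis (mono_tags, lifting) UNIV_eq_I card_field le_trans mem_Collect_eq)
  then show False
    using n_pos by simp
qed

subsection \<open>The additive character\<close>

definition chi :: "'a \<Rightarrow> int" where
  "chi x = sgn2 (Tr x)"

lemma sgn2_add:
  assumes "s = 0 \<or> s = 1" "t = 0 \<or> t = (1 :: 'a)"
  shows "sgn2 (s + t) = sgn2 s * sgn2 t"
  using assms by (auto simp: sgn2_def)

lemma chi_add: "chi (x + y) = chi x * chi y"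
  unfolding chi_def tr_1_add by (intro sgn2_add Tr_cases)

lemma chi_0 [simp]: "chi 0 = 1"
  by (simp add: chi_def)

lemma abs_chi [simp]: "\<bar>chi x\<bar> = 1"
  by (simp add: chi_def)

text \<open>Shifting by \<open>v\<close> permutes \<open>V\<close> and flips the sign of every
  term.\<close>

lemma sum_chi_eq_0:
  assumes "v \<in> V" "chi (w * v) = -1" "\<And>y. y \<in> V \<Longrightarrow> y + v \<in> V"
  shows "(\<Sum>y\<in>V. chi (w * y)) = 0"
proof -
  have "(\<Sum>y\<in>V. chi (w * (y + v))) = (\<Sum>y\<in>V. chi (w * y))"
    by (rule sum.reindex_bij_betw[of "\<lambda>y. y + v"], rule bij_betw_byWitness[where f' = "\<lambda>y. y + v"])
      (use assms in \<open>auto simp: add.assoc\<close>)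
  then show ?thesis
    using assms(2) by (simp add: distrib_left chi_add sum_negf)
qed

lemma sum_chi_UNIV: "(\<Sum>u\<in>UNIV. chi (u * w)) = (if w = 0 then q ^ 2 else 0)"
proof (cases "w = 0")
  case True
  then show ?thesis
    by (simp add: card_field power_mult mult.commute[of 2 n])
next
  case False
  obtain x where "Tr x = 1"
    using Tr_nontrivial by blast
  then have "(\<Sum>u\<in>UNIV. chi (w * u)) = 0"
    using False by (intro sum_chi_eq_0[of "x / w"]) (auto simp: chi_def sgn2_def)
  then show ?thesis
    using False by (simp add: mult.commute)
qed

section \<open>The order of the subfield and its character sums\<close>

lemma Fq_add: "x \<in> Fq \<Longrightarrow> y \<in> Fq \<Longrightarrow> x + y \<in> Fq"
  by (simp add: mem_Fq_iff cj_add)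

lemma Fq_mult: "x \<in> Fq \<Longrightarrow> y \<in> Fq \<Longrightarrow> x * y \<in> Fq"
  by (simp add: mem_Fq_iff cj_mult)

lemma Fq_divide: "x \<in> Fq \<Longrightarrow> y \<in> Fq \<Longrightarrow> x / y \<in> Fq"
  by (simp add: mem_Fq_iff cj_divide)

lemma zero_in_Fq [simp]: "0 \<in> Fq"
  by (simp add: mem_Fq_iff)

lemma trace_in_Fq: "x + cj x \<in> Fq"
  by (simp add: mem_Fq_iff cj_add add.commute)

lemma norm_in_Fq: "x * cj x \<in> Fq"
  by (simp add: mem_Fq_iff cj_mult mult.commute)

lemma ex_trace_one: "\<exists>g. g + cj g = 1"
proof -
  obtain x where x: "Tr x = 1"
    using Tr_nontrivial by blast
  define v where "v = x + cj x"
  have "v \<noteq> 0"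
    using x unfolding Tr_eq_tr_n v_def by force
  moreover have "cj v = v"
    using trace_in_Fq by (simp add: v_def mem_Fq_iff)
  ultimately have "x / v + cj (x / v) = 1"
    by (simp add: cj_divide v_def flip: add_divide_distrib)
  then show ?thesis by blast
qed

text \<open>For \<open>g\<close> of relative trace 1, \<open>1\<close> and \<open>g\<close> form a
  basis over \<open>Fq\<close>; the \<open>g\<close>-coordinate of \<open>x\<close> is
  \<open>x + cj x\<close>.\<close>

lemma card_Fq: "card Fq = 2 ^ n"
proof -
  obtain g where g: "g + cj g = 1"
    using ex_trace_one by blast
  then have cjg: "cj g = g + 1"
    by (metis add_self_left)
  have "bij_betw (\<lambda>(y, z). y + z * g) (Fq \<times> Fq) UNIV"
    unfolding bij_betw_def
  proof (intro conjI inj_onI)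
    fix p p' :: "'a \<times> 'a"
    assume "p \<in> Fq \<times> Fq" "p' \<in> Fq \<times> Fq" and eq: "(\<lambda>(y, z). y + z * g) p = (\<lambda>(y, z). y + z * g) p'"
    then obtain y z y' z' where p: "p = (y, z)" "p' = (y', z')"
      and F: "cj y = y" "cj z = z" "cj y' = y'" "cj z' = z'"
      by (auto simp: mem_Fq_iff)
    have e: "y + z * g = y' + z' * g"
      using eq by (simp add: p)
    then have "cj (y + z * g) = cj (y' + z' * g)"
      by simp
    then have "(y + z * g) + z = (y' + z' * g) + z'"
      by (simp add: cj_add cj_mult F cjg algebra_simps)
    then have "z = z'"
      by (simp add: e)
    then show "p = p'"
      using e p by simp
  next
    have "x \<in> (\<lambda>(y, z). y + z * g) ` (Fq \<times> Fq)" for x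
    proof (rule image_eqI)
      have "cj (x + (x + cj x) * g) = cj x + (x + cj x) * (g + 1)"
        by (simp add: cj_add cj_mult cjg add.commute)
      also have "\<dots> = x + (x + cj x) * g"
        by (simp add: distrib_left add_ac)
      finally show "(x + (x + cj x) * g, x + cj x) \<in> Fq \<times> Fq"
        by (simp add: mem_Fq_iff cj_add add.commute)
    qed (simp add: add.assoc)
    then show "(\<lambda>(y, z). y + z * g) ` (Fq \<times> Fq) = UNIV"
      by blast
  qed
  then have "card Fq * card Fq = 2 ^ (2 * n)"
    by (metis bij_betw_same_card card_cartesian_product card_field)
  then have "(card Fq) ^ 2 = (2 ^ n) ^ 2"
    by (simp add: power2_eq_square mult_2 power_add)
  then show ?thesis
    by (rule power2_eq_imp_eq) simp_all
qed

lemma sum_chi_Fq: "(\<Sum>y\<in>Fq. chi (w * y)) = (if w \<in> Fq then q else 0)"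
proof (cases "w \<in> Fq")
  case True
  then have "chi (w * y) = 1" if "y \<in> Fq" for y
    using that by (simp add: chi_def Tr_Fq Fq_mult del: One_nat_def)
  then show ?thesis
    using True by (simp add: card_Fq)
next
  case False
  obtain x where x: "Tr x = 1"
    using Tr_nontrivial by blast
  define t where "t = w + cj w"
  \<comment> \<open>Chosen so that \<open>w * v\<close> has the same relative trace as
    \<open>x\<close>, hence absolute trace 1.\<close>
  define v where "v = (x + cj x) / t"
  have t: "t \<noteq> 0" "t \<in> Fq"
    using False trace_in_Fq by (auto simp: t_def add_eq_0_iff_eq mem_Fq_iff)
  have v: "v \<in> Fq"
    unfolding v_def by (intro Fq_divide trace_in_Fq t)
  then have "w * v + cj (w * v) = t * v"
    by (simp add: cj_mult mem_Fq_iff t_def distrib_right)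
  also have "\<dots> = x + cj x"
    using t by (simp add: v_def)
  finally have "Tr (w * v) = 1"
    using x by (simp only: Tr_eq_tr_n)
  then have "(\<Sum>y\<in>Fq. chi (w * y)) = 0"
    using v by (intro sum_chi_eq_0[of v]) (auto simp: chi_def sgn2_def Fq_add)
  then show ?thesis
    using False by simp
qed

subsection \<open>Polar decomposition and bentness\<close>

text \<open>Uniqueness is \<open>Fq_inter_U\<close>; the factor in \<open>Fq\<close> is the square
  root of the norm.\<close>

lemma polar_bij: "bij_betw (\<lambda>(y, z). y * z) ((Fq - {0}) \<times> U) (UNIV - {0})"
  unfolding bij_betw_def
proof (intro conjI inj_onI)
  fix p p' :: "'a \<times> 'a"
  assume "p \<in> (Fq - {0}) \<times> U" "p' \<in> (Fq - {0}) \<times> U"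
    and eq: "(\<lambda>(y, z). y * z) p = (\<lambda>(y, z). y * z) p'"
  then obtain y z y' z' where p: "p = (y, z)" "p' = (y', z')"
    and F: "y \<in> Fq" "y' \<in> Fq" "y \<noteq> 0" "y' \<noteq> 0" "z \<in> U" "z' \<in> U"
    by auto
  have nz: "z \<noteq> 0" "z' \<noteq> 0"
    using F by (metis zero_notin_U)+
  have e: "y / y' = z' * inverse z"
    using eq F nz by (simp add: p field_simps)
  have "y / y' = 1"
    using Fq_inter_U[of "y / y'"] F e Fq_divide mult_in_U inverse_in_U by metis
  then show "p = p'"
    using F eq p by simp
next
  have "x \<in> (\<lambda>(y, z). y * z) ` ((Fq - {0}) \<times> U)" if "x \<noteq> 0" for x
  proof (rule image_eqI)
    \<comment> \<open>Halving the exponent in \<open>N ^ 2 ^ n = N\<close> gives the square root of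
      the norm \<open>N = x * cj x\<close>.\<close>
    define y where "y = (x * cj x) ^ (2 ^ (n - 1))"
    have y2: "y * y = x * cj x"
    proof -
      have "y * y = (x * cj x) ^ (2 * 2 ^ (n - 1))"
        by (simp add: y_def mult_2 power_add)
      also have "2 * 2 ^ (n - 1) = (2 :: nat) ^ n"
        using n_pos by (simp flip: power_Suc)
      also have "(x * cj x) ^ 2 ^ n = x * cj x"
        using norm_in_Fq[of x] by (simp add: subfield_q_def)
      finally show ?thesis .
    qed
    have y0: "y \<noteq> 0"
      using that by (simp add: y_def)
    have "cj y = (cj (x * cj x)) ^ (2 ^ (n - 1))"
      unfolding y_def conj_q_def by (simp add: mult.commute flip: power_mult)
    then have yF: "cj y = y"
      using norm_in_Fq[of x] by (simp add: mem_Fq_iff y_def)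
    have "(x / y) * cj (x / y) = 1"
      using y0 that by (simp add: cj_divide yF y2)
    then show "(y, x / y) \<in> (Fq - {0}) \<times> U"
      using y0 yF by (simp add: mem_Fq_iff mem_U_iff)
    show "x = (\<lambda>(y, z). y * z) (y, x / y)"
      using y0 by simp
  qed
  then show "(\<lambda>(y, z). y * z) ` ((Fq - {0}) \<times> U) = UNIV - {0}"
    by force
qed

lemma card_U: "card U = 2 ^ n + 1"
proof -
  have "card (Fq - {0}) * card U = card (UNIV - {0 :: 'a})"
    using bij_betw_same_card[OF polar_bij] by (simp only: card_cartesian_product)
  then have "(2 ^ n - 1) * card U = (2 ^ (2 * n) - 1 :: nat)"
    by (simp add: card_Fq card_field card_Diff_singleton)
  also have "\<dots> = (2 ^ n - 1) * (2 ^ n + 1)"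
    by (simp add: mult_2 power_add diff_mult_distrib)
  finally show ?thesis
    using n_pos by (metis mult_cancel1 one_less_power one_less_numeral_iff semiring_norm(76) zero_less_diff less_irrefl)
qed

text \<open>On \<open>U\<close> the map is \<open>z \<mapsto> inverse (z ^ 2)\<close>, and squaring
  is injective in characteristic 2.\<close>

lemma power_q_minus_1_bij: "bij_betw (\<lambda>z. z ^ (2 ^ n - 1)) U U"
proof -
  have "inj_on (\<lambda>z. z ^ (2 ^ n - 1)) U"
  proof (rule inj_onI)
    fix x y assume "x \<in> U" "y \<in> U" "x ^ (2 ^ n - 1) = y ^ (2 ^ n - 1)"
    then have "x ^ 2 = y ^ 2"
      by (metis power_q_minus_1 inverse_eq_iff_eq)
    then show "x = y"
      using power_2_power_inject[of x 1 y] by simp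
  qed
  moreover have "(\<lambda>z. z ^ (2 ^ n - 1)) ` U \<subseteq> U"
    by (auto simp: power_q_minus_1 power2_eq_square simp del: One_nat_def
        intro!: mult_in_U inverse_in_U)
  ultimately show ?thesis
    by (simp add: bij_betw_def endo_inj_surj)
qed

text \<open>On each punctured line \<open>(Fq - {0}) * z\<close> the function is constant, since
  \<open>y ^ (2 ^ n - 1) = 1\<close> there; the \<open>- 1\<close> accounts for the removed point
  0.\<close>

lemma walsh_polar:
  fixes g :: "'a \<Rightarrow> 'a"
  assumes g: "\<And>x. g x = 0 \<or> g x = 1"
  shows "walsh (2 * n) (\<lambda>x. g (x ^ (2 ^ n - 1))) \<omega> =
    sgn2 (g 0) + (\<Sum>z\<in>U. sgn2 (g (z ^ (2 ^ n - 1))) * ((if \<omega> * z \<in> Fq then q else 0) - 1))"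
proof -
  have inner: "(\<Sum>y\<in>Fq - {0}. chi (\<omega> * z * y)) = (if \<omega> * z \<in> Fq then q else 0) - 1" for z
    using sum_chi_Fq[of "\<omega> * z"] by (simp add: sum.remove[of Fq 0])
  define G where "G x = sgn2 (g (x ^ (2 ^ n - 1))) * chi (\<omega> * x)" for x
  have "walsh (2 * n) (\<lambda>x. g (x ^ (2 ^ n - 1))) \<omega> = (\<Sum>x\<in>UNIV. G x)"
    unfolding walsh_def G_def chi_def
    by (subst sgn2_add[OF g Tr_cases, symmetric]) (simp add: sgn2_def)
  also have "\<dots> = G 0 + (\<Sum>x\<in>UNIV - {0}. G x)"
    by (simp add: sum.remove)
  also have "G 0 = sgn2 (g 0)"
    using one_less_power[of "2 :: nat" n] n_pos by (simp add: G_def power_0_left)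
  also have "(\<Sum>x\<in>UNIV - {0}. G x) = (\<Sum>(y, z)\<in>(Fq - {0}) \<times> U. G (y * z))"
    by (subst sum.reindex_bij_betw[OF polar_bij, symmetric]) (simp add: case_prod_unfold)
  also have "\<dots> = (\<Sum>z\<in>U. \<Sum>y\<in>Fq - {0}. G (y * z))"
    by (subst sum.cartesian_product[symmetric]) (rule sum.swap)
  also have "\<dots> = (\<Sum>z\<in>U. sgn2 (g (z ^ (2 ^ n - 1))) * (\<Sum>y\<in>Fq - {0}. chi (\<omega> * z * y)))"
  proof (intro sum.cong refl)
    fix z
    have "G (y * z) = sgn2 (g (z ^ (2 ^ n - 1))) * chi (\<omega> * z * y)" if "y \<in> Fq - {0}" for y
    proof -
      have "y ^ (2 ^ n - 1) * y = y ^ 2 ^ n"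
        by (simp flip: power_Suc2)
      then have "y ^ (2 ^ n - 1) = 1"
        using that by (simp add: subfield_q_def)
      then show ?thesis
        by (simp add: G_def power_mult_distrib mult_ac)
    qed
    then show "(\<Sum>y\<in>Fq - {0}. G (y * z)) =
        sgn2 (g (z ^ (2 ^ n - 1))) * (\<Sum>y\<in>Fq - {0}. chi (\<omega> * z * y))"
      by (simp add: sum_distrib_left)
  qed
  finally show ?thesis
    unfolding inner .
qed

text \<open>With \<open>S\<close> the sum over \<open>U\<close>, the transform at 0 is
  \<open>sgn2 (g 0) + S * (q - 1)\<close>. At a nonzero frequency exactly one \<open>z\<close> in
  \<open>U\<close> has \<open>\<omega> * z\<close> in \<open>Fq\<close>, which leaves
  \<open>sgn2 (g 0) - S\<close> plus or minus \<open>q\<close>.\<close>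

lemma bent_iff_sum_U:
  fixes g :: "'a \<Rightarrow> 'a"
  assumes g: "\<And>x. g x = 0 \<or> g x = 1" and n: "n \<ge> 2"
  shows "bent (2 * n) (\<lambda>x. g (x ^ (2 ^ n - 1))) \<longleftrightarrow> (\<Sum>\<eta>\<in>U. sgn2 (g \<eta>)) = sgn2 (g 0)"
proof -
  define S where "S = (\<Sum>\<eta>\<in>U. sgn2 (g \<eta>))"
  define W where "W = walsh (2 * n) (\<lambda>x. g (x ^ (2 ^ n - 1)))"
  have S: "(\<Sum>z\<in>U. sgn2 (g (z ^ (2 ^ n - 1)))) = S"
    unfolding S_def by (rule sum.reindex_bij_betw[OF power_q_minus_1_bij])
  have W0: "W 0 = sgn2 (g 0) + S * (q - 1)"
    unfolding W_def walsh_polar[of g, OF g] S[symmetric] by (simp add: sum_distrib_right)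
  have W: "\<exists>e. (e = 1 \<or> e = -1) \<and> W \<omega> = sgn2 (g 0) - S + e * q" if "\<omega> \<noteq> 0" for \<omega>
  proof -
    have "inverse \<omega> \<in> UNIV - {0}"
      using that by simp
    then have "inverse \<omega> \<in> (\<lambda>(y, z). y * z) ` ((Fq - {0}) \<times> U)"
      by (simp only: bij_betw_imp_surj_on[OF polar_bij])
    then obtain y z where yz: "y \<in> Fq" "y \<noteq> 0" "z \<in> U" "inverse \<omega> = y * z"
      by auto
    have "\<omega> * z = 1 / y"
      using yz that by (simp add: field_simps)
    then have zF: "\<omega> * z \<in> Fq"
      using yz by (simp add: mem_Fq_iff cj_divide)
    have uniq: "z' = z" if z': "z' \<in> U" "\<omega> * z' \<in> Fq" for z'
    proof -
      have nz: "z \<noteq> 0"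
        using yz by (metis zero_notin_U)
      have "(\<omega> * z') / (\<omega> * z) = z' * inverse z"
        using \<open>\<omega> \<noteq> 0\<close> nz by (simp add: field_simps)
      then have "z' * inverse z = 1"
        using Fq_inter_U Fq_divide[OF z'(2) zF] mult_in_U[OF z'(1) inverse_in_U[OF yz(3)]] by simp
      then show ?thesis
        using nz by (simp add: field_simps)
    qed
    have "W \<omega> = sgn2 (g 0) + (\<Sum>z\<in>U. sgn2 (g (z ^ (2 ^ n - 1))) * (if \<omega> * z \<in> Fq then q else 0)) - S"
      unfolding W_def walsh_polar[of g, OF g] S[symmetric]
      by (simp add: right_diff_distrib sum_subtractf)
    also have "(\<Sum>z\<in>U. sgn2 (g (z ^ (2 ^ n - 1))) * (if \<omega> * z \<in> Fq then q else 0)) =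
        (\<Sum>z'\<in>U. if z' = z then sgn2 (g (z ^ (2 ^ n - 1))) * q else 0)"
    proof (rule sum.cong[OF refl])
      fix z' assume "z' \<in> U"
      then have "\<omega> * z' \<in> Fq \<longleftrightarrow> z' = z"
        using zF uniq by metis
      then show "sgn2 (g (z' ^ (2 ^ n - 1))) * (if \<omega> * z' \<in> Fq then q else 0) =
          (if z' = z then sgn2 (g (z ^ (2 ^ n - 1))) * q else 0)"
        by simp
    qed
    also have "\<dots> = sgn2 (g (z ^ (2 ^ n - 1))) * q"
      using yz by simp
    finally show ?thesis
      using sgn2_cases[of "g (z ^ (2 ^ n - 1))"] by (intro exI[of _ "sgn2 (g (z ^ (2 ^ n - 1)))"]) auto
  qed
  have q2: "(2 :: int) ^ (2 * n) = q ^ 2"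
    by (simp add: power_even_eq)
  have "bent (2 * n) (\<lambda>x. g (x ^ (2 ^ n - 1))) \<longleftrightarrow> (\<forall>\<omega>. (W \<omega>) ^ 2 = q ^ 2)"
    by (simp add: bent_def W_def q2)
  also have "\<dots> \<longleftrightarrow> S = sgn2 (g 0)"
  proof
    assume S0: "S = sgn2 (g 0)"
    show "\<forall>\<omega>. (W \<omega>) ^ 2 = q ^ 2"
    proof
      fix \<omega>
      show "(W \<omega>) ^ 2 = q ^ 2"
      proof (cases "\<omega> = 0")
        case True
        have "W \<omega> = sgn2 (g 0) * q"
          using W0 by (simp add: True S0 algebra_simps)
        then show ?thesis
          using sgn2_cases[of "g 0"] by (auto simp: power_mult_distrib)
      next
        case False
        then show ?thesis
          using W[OF False] S0 by auto
      qed
    qed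
  next
    assume "\<forall>\<omega>. (W \<omega>) ^ 2 = q ^ 2"
    then have "W 1 = q \<or> W 1 = - q"
      by (simp add: power2_eq_iff)
    \<comment> \<open>The two nonzero values are excluded by
      \<open>\<bar>S\<bar> \<le> q + 1\<close>, because \<open>q + 2 < 2 * q\<close>.\<close>
    then have *: "sgn2 (g 0) - S \<in> {0, 2 * q, - 2 * q}"
      using W[of 1] by auto
    have "\<bar>S\<bar> \<le> (\<Sum>\<eta>\<in>U. 1)"
      unfolding S_def by (rule order.trans[OF sum_abs]) simp
    then have "\<bar>S\<bar> \<le> q + 1"
      by (simp add: card_U)
    moreover have "q \<ge> 2 ^ 2"
      using n by (intro power_increasing) auto
    ultimately show "S = sgn2 (g 0)"
      using * sgn2_cases[of "g 0"] by auto
  qed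
  finally show ?thesis
    by (simp add: S_def)
qed

subsection \<open>Exponential sums over the unit circle\<close>

definition circle_sum :: "'a \<Rightarrow> int" where
  "circle_sum u = (\<Sum>\<eta>\<in>U. chi (u * \<eta>))"

lemma circle_sum_0: "circle_sum 0 = q + 1"
  by (simp add: circle_sum_def card_U)

lemma circle_sum_mult_U:
  assumes "\<theta> \<in> U"
  shows "circle_sum (u * \<theta>) = circle_sum u"
proof -
  have "\<theta> \<noteq> 0"
    using assms by (metis zero_notin_U)
  then have "bij_betw (\<lambda>\<eta>. \<theta> * \<eta>) U U"
    using assms mult_in_U inverse_in_U
    by (intro bij_betw_byWitness[where f' = "\<lambda>\<eta>. inverse \<theta> * \<eta>"]) auto
  then have "(\<Sum>\<eta>\<in>U. chi (u * (\<theta> * \<eta>))) = (\<Sum>\<eta>\<in>U. chi (u * \<eta>))"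
    by (rule sum.reindex_bij_betw)
  then show ?thesis
    by (simp add: circle_sum_def mult.assoc)
qed

section \<open>Second and fourth moments of the circle sums\<close>

lemma parseval:
  assumes "finite A"
  shows "(\<Sum>u\<in>UNIV. (\<Sum>p\<in>A. chi (u * f p)) ^ 2) = q ^ 2 * (\<Sum>p\<in>A. int (card {p' \<in> A. f p' = f p}))"
proof -
  have "(\<Sum>u\<in>UNIV. (\<Sum>p\<in>A. chi (u * f p)) ^ 2) = (\<Sum>u\<in>UNIV. \<Sum>p\<in>A. \<Sum>p'\<in>A. chi (u * (f p + f p')))"
    by (simp add: power2_eq_square sum_product distrib_left chi_add)
  also have "\<dots> = (\<Sum>p\<in>A. \<Sum>p'\<in>A. \<Sum>u\<in>UNIV. chi (u * (f p + f p')))"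
    by (subst sum.swap, rule sum.cong[OF refl], rule sum.swap)
  \<comment> \<open>Orthogonality over \<open>u\<close> keeps only the pairs with equal values of
    \<open>f\<close>.\<close>
  also have "\<dots> = (\<Sum>p\<in>A. \<Sum>p'\<in>A. if f p' = f p then q ^ 2 else 0)"
    by (intro sum.cong refl) (auto simp: sum_chi_UNIV add_eq_0_iff_eq)
  also have "\<dots> = (\<Sum>p\<in>A. q ^ 2 * int (card {p' \<in> A. f p' = f p}))"
    using assms by (simp add: mult.commute flip: sum.inter_filter)
  finally show ?thesis
    by (simp add: sum_distrib_left)
qed

lemma circle_sum_second_moment: "(\<Sum>u\<in>UNIV. circle_sum u ^ 2) = q ^ 2 * (q + 1)"
proof -
  have "{p'. p' \<in> U \<and> p' = p} = {p}" if "p \<in> U" for p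
    using that by auto
  then show ?thesis
    using parseval[of U "\<lambda>\<eta>. \<eta>"] by (simp add: circle_sum_def card_U)
qed

text \<open>On \<open>U\<close> the conjugate of a sum is the sum divided by the product, so a
  nonzero sum determines the product, and both pairs are the roots of one quadratic.\<close>

lemma U_add_eq_imp:
  assumes "a \<in> U" "b \<in> U" "\<eta> \<in> U" "\<theta> \<in> U" "\<eta> \<noteq> \<theta>" "a + b = \<eta> + \<theta>"
  shows "a = \<eta> \<and> b = \<theta> \<or> a = \<theta> \<and> b = \<eta>"
proof -
  have nz: "a \<noteq> 0" "b \<noteq> 0" "\<eta> \<noteq> 0" "\<theta> \<noteq> 0"
    using assms by (metis zero_notin_U)+
  have cj_sum: "cj (x + y) = (x + y) / (x * y)" if "x \<in> U" "y \<in> U" "x \<noteq> 0" "y \<noteq> 0" for x y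
    using that by (simp add: cj_add cj_U field_simps)
  have "(\<eta> + \<theta>) / (a * b) = (\<eta> + \<theta>) / (\<eta> * \<theta>)"
    using cj_sum[of a b] cj_sum[of \<eta> \<theta>] assms nz by metis
  moreover have "\<eta> + \<theta> \<noteq> 0"
    using assms(5) by (simp add: add_eq_0_iff_eq)
  ultimately have ab: "a * b = \<eta> * \<theta>"
    using nz by (simp add: field_simps)
  have "(a + \<eta>) * (a + \<theta>) = a * a + a * (\<eta> + \<theta>) + \<eta> * \<theta>"
    by (simp add: algebra_simps)
  also have "\<dots> = a * a + a * (a + b) + a * b"
    by (simp only: ab assms(6))
  also have "\<dots> = 0"
    by (simp add: distrib_left add.assoc)
  finally have "a = \<eta> \<or> a = \<theta>"
    by (simp add: add_eq_0_iff_eq)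
  then show ?thesis
    using assms(6) by (auto simp: add.commute)
qed

text \<open>By \<open>parseval\<close> this counts coincidences of sums of two elements of
  \<open>U\<close>: a diagonal pair has sum 0 and matches all \<open>q + 1\<close> diagonal pairs,
  any other pair only itself and its swap.\<close>

lemma circle_sum_fourth_moment: "(\<Sum>u\<in>UNIV. circle_sum u ^ 4) \<le> q ^ 2 * ((q + 1) * (3 * q + 1))"
proof -
  let ?f = "\<lambda>p :: 'a \<times> 'a. fst p + snd p"
  have "circle_sum u ^ 4 = (\<Sum>p\<in>U \<times> U. chi (u * ?f p)) ^ 2" for u
  proof -
    have "circle_sum u ^ 2 = (\<Sum>p\<in>U \<times> U. chi (u * ?f p))"
      by (simp add: circle_sum_def power2_eq_square sum_product sum.cartesian_product distrib_left
          chi_add case_prod_unfold)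
    moreover have "circle_sum u ^ 4 = (circle_sum u ^ 2) ^ 2"
      by (simp flip: power_mult)
    ultimately show ?thesis
      by simp
  qed
  then have "(\<Sum>u\<in>UNIV. circle_sum u ^ 4) =
      q ^ 2 * (\<Sum>p\<in>U \<times> U. int (card {p' \<in> U \<times> U. ?f p' = ?f p}))"
    by (simp only: parseval finite)
  also have "(\<Sum>p\<in>U \<times> U. int (card {p' \<in> U \<times> U. ?f p' = ?f p})) \<le>
      (\<Sum>p\<in>U \<times> U. if fst p = snd p then q + 1 else 2)"
  proof (rule sum_mono)
    fix p assume p: "p \<in> U \<times> U"
    show "int (card {p' \<in> U \<times> U. ?f p' = ?f p}) \<le> (if fst p = snd p then q + 1 else 2)"
    proof (cases "fst p = snd p")
      case True
      have "{p' \<in> U \<times> U. ?f p' = ?f p} = (\<lambda>x. (x, x)) ` U"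
        using True by (auto simp: add_eq_0_iff_eq)
      then have "card {p' \<in> U \<times> U. ?f p' = ?f p} = card U"
        by (simp add: card_image inj_on_def)
      then show ?thesis
        using True by (simp add: card_U)
    next
      case False
      have "{p' \<in> U \<times> U. ?f p' = ?f p} \<subseteq> {(fst p, snd p), (snd p, fst p)}"
        using p False U_add_eq_imp by fastforce
      then have "card {p' \<in> U \<times> U. ?f p' = ?f p} \<le> card {(fst p, snd p), (snd p, fst p)}"
        by (intro card_mono) auto
      also have "\<dots> \<le> 2"
        by (simp add: card_insert_if)
      finally show ?thesis
        using False by simp
    qed
  qed
  also have "\<dots> = (\<Sum>x\<in>U. \<Sum>y\<in>U. 2 + (if x = y then q - 1 else 0))"
    unfolding sum.cartesian_product by (intro sum.cong) auto
  also have "\<dots> = (q + 1) * (3 * q + 1)"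
    by (simp add: sum.distrib card_U algebra_simps)
  finally show ?thesis
    by simp
qed

text \<open>Elements of one coset of \<open>U\<close> have the same circle sum, so every coset contributes
  \<open>q + 1\<close> equal terms to the moments.\<close>
lemma circle_sum_coset_bound:
  assumes V: "0 \<notin> V" "\<And>u v. u \<in> V \<Longrightarrow> v \<in> V \<Longrightarrow> u / v \<in> U \<Longrightarrow> u = v"
  shows "(\<Sum>u\<in>V. (circle_sum u ^ 2 - q) ^ 2) \<le> q ^ 3 - q ^ 2 - q - 1"
proof -
  \<comment> \<open>The average of \<open>circle_sum u ^ 2\<close> over nonzero \<open>u\<close> is
    \<open>q - 1 / (q - 1)\<close>, so \<open>q\<close> is nearly the optimal centre.\<close>
  define d where "d u = (circle_sum u ^ 2 - q) ^ 2" for u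
  have "(\<Sum>u\<in>UNIV. d u) =
      (\<Sum>u\<in>UNIV. circle_sum u ^ 4) - 2 * q * (\<Sum>u\<in>UNIV. circle_sum u ^ 2) + q ^ 2 * (\<Sum>u\<in>(UNIV :: 'a set). 1)"
    by (simp add: d_def power2_diff sum.distrib sum_subtractf sum_distrib_left algebra_simps
        flip: power_mult)
  also have "(\<Sum>u\<in>(UNIV :: 'a set). 1) = q ^ 2"
    by (simp add: card_field power_mult mult.commute)
  also have "(\<Sum>u\<in>UNIV. circle_sum u ^ 4) - 2 * q * (\<Sum>u\<in>UNIV. circle_sum u ^ 2) + q ^ 2 * q ^ 2 \<le>
      q ^ 2 * ((q + 1) * (3 * q + 1)) - 2 * q * (q ^ 2 * (q + 1)) + q ^ 2 * q ^ 2"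
    using circle_sum_fourth_moment by (simp only: circle_sum_second_moment)
  finally have upper: "(\<Sum>u\<in>UNIV. d u) \<le>
      q ^ 2 * ((q + 1) * (3 * q + 1)) - 2 * q * (q ^ 2 * (q + 1)) + q ^ 2 * q ^ 2" .
  let ?m = "\<lambda>(u, \<theta>). u * \<theta> :: 'a"
  have inj: "inj_on ?m (V \<times> U)"
  proof (rule inj_onI)
    fix p p' assume "p \<in> V \<times> U" "p' \<in> V \<times> U" and eq: "?m p = ?m p'"
    then obtain u \<theta> u' \<theta>' where p: "p = (u, \<theta>)" "p' = (u', \<theta>')"
      and m: "u \<in> V" "u' \<in> V" "\<theta> \<in> U" "\<theta>' \<in> U"
      by auto
    have nz: "u \<noteq> 0" "u' \<noteq> 0" "\<theta> \<noteq> 0" "\<theta>' \<noteq> 0"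
      using m V(1) by (metis zero_notin_U)+
    have "u / u' = \<theta>' * inverse \<theta>"
      using eq nz by (simp add: p field_simps)
    then have "u = u'"
      using V(2) m mult_in_U inverse_in_U by metis
    then show "p = p'"
      using eq nz p by simp
  qed
  have "(\<Sum>x\<in>?m ` (V \<times> U). d x) = (\<Sum>p\<in>V \<times> U. d (?m p))"
    by (simp add: sum.reindex[OF inj])
  also have "\<dots> = (\<Sum>u\<in>V. \<Sum>\<theta>\<in>U. d (u * \<theta>))"
    by (simp add: sum.cartesian_product case_prod_unfold)
  also have "\<dots> = (\<Sum>u\<in>V. (q + 1) * d u)"
    by (simp add: d_def circle_sum_mult_U card_U add.commute)
  finally have cosets: "(\<Sum>x\<in>?m ` (V \<times> U). d x) = (q + 1) * (\<Sum>u\<in>V. d u)"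
    by (simp add: sum_distrib_left)
  have "0 \<notin> ?m ` (V \<times> U)"
    using V(1) by auto
  \<comment> \<open>The point 0 lies in no coset; its large share
    \<open>((q + 1) ^ 2 - q) ^ 2\<close> is split off.\<close>
  then have "d 0 + (\<Sum>x\<in>?m ` (V \<times> U). d x) = (\<Sum>x\<in>insert 0 (?m ` (V \<times> U)). d x)"
    by simp
  also have "\<dots> \<le> (\<Sum>u\<in>UNIV. d u)"
    by (rule sum_mono2) (auto simp: d_def)
  finally have "((q + 1) ^ 2 - q) ^ 2 + (q + 1) * (\<Sum>u\<in>V. d u) \<le>
      q ^ 2 * ((q + 1) * (3 * q + 1)) - 2 * q * (q ^ 2 * (q + 1)) + q ^ 2 * q ^ 2"
    using upper cosets by (simp add: d_def circle_sum_0)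
  \<comment> \<open>What remains is \<open>q ^ 4 - 2 * q ^ 2 - 2 * q - 1\<close>, which is divisible
    by \<open>q + 1\<close>.\<close>
  then have "(q + 1) * (\<Sum>u\<in>V. d u) \<le> (q + 1) * (q ^ 3 - q ^ 2 - q - 1)"
    by (simp add: algebra_simps power2_eq_square power3_eq_cube)
  moreover have "q + 1 > 0"
    by (simp add: add_pos_pos)
  ultimately show ?thesis
    unfolding d_def by (simp only: mult_le_cancel_left_pos)
qed

section \<open>Pointwise bounds on the circle sums\<close>

lemma circle_sum_bound:
  assumes "n \<ge> 7" "u \<noteq> 0"
  shows "3 * \<bar>circle_sum u\<bar> < q - 1"
proof (rule ccontr)
  assume "\<not> ?thesis"
  then have "q - 1 \<le> 3 * \<bar>circle_sum u\<bar>" by simp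
  moreover have q: "q \<ge> 128"
    using power_increasing[of 7 n "2 :: int"] assms by simp
  ultimately have "(q - 1) ^ 2 \<le> (3 * \<bar>circle_sum u\<bar>) ^ 2"
    by (intro power_mono) auto
  then have "q * (q - 11) \<le> 9 * (circle_sum u ^ 2 - q)"
    by (simp add: power2_eq_square algebra_simps)
  moreover have "0 \<le> q * (q - 11)"
    using q by simp
  ultimately have "(q * (q - 11)) ^ 2 \<le> (9 * (circle_sum u ^ 2 - q)) ^ 2"
    by (intro power_mono)
  also have "\<dots> = 81 * (circle_sum u ^ 2 - q) ^ 2"
    unfolding power_mult_distrib by simp
  also have "\<dots> \<le> 81 * (q ^ 3 - q ^ 2 - q - 1)"
    using circle_sum_coset_bound[of "{u}"] assms by simp
  also have "\<dots> \<le> 81 * q ^ 3"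
    by (simp, rule order.trans[of _ 0]) (use q in simp_all)
  finally have "q ^ 2 * (q - 11) ^ 2 \<le> q ^ 2 * (81 * q)"
    by (simp add: power_mult_distrib power2_eq_square power3_eq_cube)
  then have "(q - 11) ^ 2 \<le> 81 * q"
    by (simp add: mult_le_cancel_left_pos)
  \<comment> \<open>This fails for \<open>q \<ge> 128\<close> but holds for \<open>q = 64\<close>,
    hence the separate treatment of \<open>n = 6\<close>.\<close>
  then have "q * (q - 103) + 121 \<le> 0"
    by (simp add: power2_eq_square algebra_simps)
  moreover have "q * (q - 103) \<ge> 0"
    using q by simp
  ultimately show False by simp
qed

text \<open>Two distinct cosets share the moment bound, which is 257983 for \<open>q = 64\<close>,
  so their sums cannot both be large.\<close>

lemma circle_sum_bound_6:
  assumes "n = 6" "u \<noteq> 0" "v \<noteq> 0" "u / v \<notin> U"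
  shows "2 * \<bar>circle_sum u\<bar> + \<bar>circle_sum v\<bar> < q - 1"
proof -
  define X Y where "X = \<bar>circle_sum u\<bar>" and "Y = \<bar>circle_sum v\<bar>"
  have "v / u \<notin> U"
    using assms(4) inverse_in_U[of "v / u"] by auto
  moreover have "u \<noteq> v"
    using assms(3,4) one_in_U by (metis divide_self)
  moreover have "(\<Sum>x\<in>{u, v}. (circle_sum x ^ 2 - q) ^ 2) \<le> q ^ 3 - q ^ 2 - q - 1"
    by (rule circle_sum_coset_bound) (use assms(2-4) calculation in auto)
  moreover have q: "q = 64"
    using assms(1) by simp
  ultimately have "(circle_sum u ^ 2 - 64) ^ 2 + (circle_sum v ^ 2 - 64) ^ 2 \<le> 257983"
    unfolding q by simp
  then have b: "(X ^ 2 - 64) ^ 2 \<le> 257983 - (Y ^ 2 - 64) ^ 2"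
    by (simp add: X_def Y_def)
  \<comment> \<open>24 is the first value too large on its own: \<open>24 ^ 2 - 64 = 512\<close> and
    \<open>512 ^ 2 = 262144\<close>.\<close>
  have le: "Z < 24" if "(Z ^ 2 - 64) ^ 2 \<le> 257983" for Z :: int
  proof (rule ccontr)
    assume "\<not> Z < 24"
    then have "24 ^ 2 \<le> Z ^ 2"
      by (intro power_mono) auto
    then have "512 ^ 2 \<le> (Z ^ 2 - 64) ^ 2"
      by (intro power_mono) auto
    then show False
      using that by simp
  qed
  have X: "X < 24"
    using b by (intro le) (smt (verit) zero_le_power2)
  have Y: "Y < 24"
    using b by (intro le) (smt (verit) zero_le_power2)
  have "2 * X + Y < 63"
  proof (rule ccontr)
    assume *: "\<not> 2 * X + Y < 63"
    \<comment> \<open>\<open>Y \<le> 23\<close> forces \<open>X \<ge> 20\<close>. For each such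
      \<open>X\<close> the least admissible \<open>Y\<close>, namely \<open>k\<close>, already
      breaks the bound; \<open>k \<ge> 8\<close> makes \<open>(k ^ 2 - 64) ^ 2\<close>
      monotone.\<close>
    then have "X \<in> {20, 21, 22, 23}"
      using X Y by auto
    moreover define k where "k = 63 - 2 * X"
    ultimately have k: "k \<ge> 8" "Y \<ge> k" "(X ^ 2 - 64) ^ 2 + (k ^ 2 - 64) ^ 2 > 257983"
      using * by auto
    have "k ^ 2 \<le> Y ^ 2"
      using k by (intro power_mono) auto
    moreover have "8 ^ 2 \<le> k ^ 2"
      using k by (intro power_mono) auto
    ultimately have "(k ^ 2 - 64) ^ 2 \<le> (Y ^ 2 - 64) ^ 2"
      by (intro power_mono) auto
    then show False
      using k b by simp
  qed
  then show ?thesis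
    unfolding q by (simp add: X_def Y_def)
qed

text \<open>An equilateral triangle \<open>1 + \<omega> + \<omega>\<^sup>2 = 0\<close> on \<open>U\<close> would consist of cube roots of unity,
  which lie in \<open>F_q\<close> when \<open>n\<close> is even.\<close>
lemma no_triangle_in_U:
  assumes "even n" "x \<in> U" "1 + x \<in> U"
  shows False
proof -
  have "x \<noteq> 0"
    using assms by (metis zero_notin_U)
  moreover have "(1 + x) * (1 + inverse x) = 1"
    using assms(3) cj_U[OF assms(2)] by (simp add: mem_U_iff cj_add)
  ultimately have "(1 + x) * (x + 1) = x"
    by (simp add: field_simps)
  then have x2: "x ^ 2 = x + 1"
    by (simp add: algebra_simps power2_eq_square) (metis add_self_left add.commute)
  have "x ^ 2 ^ (2 * k) = x" for k
  proof (induction k)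
    case (Suc k)
    have "x ^ 4 = (x ^ 2) ^ 2"
      by (simp flip: power_mult)
    also have "\<dots> = x ^ 2 + 1"
      using power_2_power_add[of x 1 1] by (simp add: x2)
    also have "\<dots> = x"
      by (simp add: x2 add.assoc)
    finally have "x ^ 4 = x" .
    then have "(x ^ 2 ^ (2 * k)) ^ 4 = x"
      by (simp add: Suc)
    then show ?case
      by (simp add: mult.commute flip: power_mult)
  qed simp
  then have "x \<in> Fq"
    using assms(1) by (auto simp: subfield_q_def elim!: evenE)
  then have "x = 1"
    using assms(2) Fq_inter_U by blast
  then show False
    using assms(3) by simp
qed

text \<open>For \<open>n = 6\<close> the three arguments meet at least two cosets; when
  \<open>u\<close> shares its coset with one of the others, the claim is
  \<open>circle_sum_bound_6\<close> itself.\<close>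

lemma circle_sum_triple_bound:
  assumes "n \<ge> 6" "u \<noteq> 0" "v \<noteq> 0" "u \<noteq> v"
  shows "\<bar>circle_sum u\<bar> + \<bar>circle_sum v\<bar> + \<bar>circle_sum (u + v)\<bar> < q - 1"
proof (cases "n = 6")
  case False
  then have n: "n \<ge> 7"
    using assms by simp
  have "u + v \<noteq> 0"
    using assms by (simp add: add_eq_0_iff_eq)
  then show ?thesis
    using circle_sum_bound[OF n assms(2)] circle_sum_bound[OF n assms(3)]
      circle_sum_bound[OF n, of "u + v"] by linarith
next
  case True
  define w where "w = u + v"
  have w: "w \<noteq> 0"
    using assms by (simp add: w_def add_eq_0_iff_eq)
  note B = circle_sum_bound_6[OF True]
  have same: "circle_sum x = circle_sum y" if "x / y \<in> U" "y \<noteq> 0" for x y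
    using circle_sum_mult_U[OF that(1), of y] that(2) by simp
  have "v / u \<notin> U \<or> w / u \<notin> U"
  proof (rule ccontr)
    assume "\<not> ?thesis"
    moreover have "w / u = 1 + v / u"
      using assms by (simp add: w_def add_divide_distrib)
    ultimately show False
      using no_triangle_in_U[of "v / u"] True by simp
  qed
  then consider "v / u \<notin> U" "w / u \<in> U" | "v / u \<in> U" "w / u \<notin> U" | "v / u \<notin> U" "w / u \<notin> U"
    by blast
  then show ?thesis
  proof cases
    case 1
    then show ?thesis
      using B[of u v] same[of w u] assms inverse_in_U[of "u / v"] by (auto simp: w_def)
  next
    case 2
    then show ?thesis
      using B[of u w] same[of v u] assms w inverse_in_U[of "u / w"] by (auto simp: w_def)
  next
    case 3
    have uv: "u / v \<notin> U" and uw: "u / w \<notin> U"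
      using 3 inverse_in_U[of "u / v"] inverse_in_U[of "u / w"] by auto
    \<comment> \<open>Here \<open>v\<close> and \<open>w\<close> may share a coset, so only pairs
      with \<open>u\<close> are compared; half the sum of the second and fourth bounds is the
      claim.\<close>
    have "2 * \<bar>circle_sum u\<bar> + \<bar>circle_sum v\<bar> < q - 1"
      "2 * \<bar>circle_sum v\<bar> + \<bar>circle_sum u\<bar> < q - 1"
      "2 * \<bar>circle_sum u\<bar> + \<bar>circle_sum w\<bar> < q - 1"
      "2 * \<bar>circle_sum w\<bar> + \<bar>circle_sum u\<bar> < q - 1"
      using B 3 uv uw assms w by auto
    then show ?thesis
      unfolding w_def[symmetric] by linarith
  qed
qed

subsection \<open>Exponential sums with a pole\<close>

definition pole_sum :: "'a \<Rightarrow> 'a \<Rightarrow> int" where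
  "pole_sum b a = (\<Sum>\<eta>\<in>U. chi (a / (\<eta> + b)))"

text \<open>For bits, \<open>2 (-1)^(s t) = 1 + (-1)^s + (-1)^t - (-1)^(s + t)\<close>.\<close>

lemma sum_U_product:
  "2 * (\<Sum>\<eta>\<in>U. sgn2 (Tr (a1 / (\<eta> + b)) * Tr (a2 / (\<eta> + b)))) =
    q + 1 + pole_sum b a1 + pole_sum b a2 - pole_sum b (a1 + a2)"
proof -
  have "2 * sgn2 (Tr x * Tr y) = 1 + chi x + chi y - chi (x + y)" for x y
    using Tr_cases[of x] Tr_cases[of y] unfolding chi_add unfolding chi_def
    by (elim disjE) (simp_all add: sgn2_def del: One_nat_def)
  then have "2 * (\<Sum>\<eta>\<in>U. sgn2 (Tr (a1 / (\<eta> + b)) * Tr (a2 / (\<eta> + b)))) =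
      (\<Sum>\<eta>\<in>U. 1 + chi (a1 / (\<eta> + b)) + chi (a2 / (\<eta> + b)) - chi (a1 / (\<eta> + b) + a2 / (\<eta> + b)))"
    by (simp only: sum_distrib_left)
  then show ?thesis
    by (simp add: pole_sum_def sum.distrib sum_subtractf card_U add_divide_distrib)
qed

text \<open>For a pole off the circle, \<open>\<eta> \<mapsto> 1/(\<eta> + b)\<close> maps \<open>U\<close> onto the circle with
  centre \<open>cj b / D\<close> and radius \<open>1 / D\<close>, where \<open>D = 1 + b * cj b\<close>.\<close>
lemma pole_sum_off_circle:
  assumes b: "b \<notin> U"
  shows "\<bar>pole_sum b a\<bar> = \<bar>circle_sum (a / (1 + b * cj b))\<bar>"
proof -
  define D where "D = 1 + b * cj b"
  have D: "D \<noteq> 0"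
    using b unfolding D_def add_eq_0_iff_eq by (metis mem_U_iff)
  \<comment> \<open>Obtained by solving
    \<open>1 / (\<eta> + b) = (cj b + \<phi> \<eta>) / D\<close>.\<close>
  define \<phi> where "\<phi> \<eta> = (1 + cj b * \<eta>) / (\<eta> + b)" for \<eta>
  have nz: "\<eta> + b \<noteq> 0" if "\<eta> \<in> U" for \<eta>
    using that b by (auto simp: add_eq_0_iff_eq)
  have \<phi>: "1 / (\<eta> + b) = (cj b + \<phi> \<eta>) / D" if "\<eta> \<in> U" for \<eta>
  proof -
    have "(cj b + \<phi> \<eta>) * (\<eta> + b) = cj b * (\<eta> + b) + (1 + cj b * \<eta>)"
      using nz[OF that] by (simp only: \<phi>_def distrib_right[of "cj b"] nonzero_divide_eq_eq)
        simp
    also have "\<dots> = D"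
      by (simp add: D_def algebra_simps)
    finally show ?thesis
      using nz[OF that] D by (simp add: frac_eq_eq)
  qed
  have "\<phi> \<eta> \<in> U" if "\<eta> \<in> U" for \<eta>
  proof -
    have "\<eta> \<noteq> 0"
      using that by (metis zero_notin_U)
    \<comment> \<open>As \<open>cj \<eta>\<close> inverts \<open>\<eta>\<close>, the numerator is
      \<open>\<eta> * cj (\<eta> + b)\<close>.\<close>
    then have "\<phi> \<eta> = \<eta> * (cj (\<eta> + b) / (\<eta> + b))"
      using that by (simp add: \<phi>_def cj_add cj_U distrib_left mult.commute)
    moreover have "cj (\<eta> + b) / (\<eta> + b) \<in> U"
      using nz[OF that] by (simp add: mem_U_iff cj_divide)
    ultimately show ?thesis
      using that by (simp only: mult_in_U)
  qed
  moreover have "inj_on \<phi> U"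
  proof (rule inj_onI)
    fix x y assume "x \<in> U" "y \<in> U" "\<phi> x = \<phi> y"
    then have "1 / (x + b) = 1 / (y + b)"
      by (simp only: \<phi>)
    then show "x = y"
      by simp
  qed
  ultimately have bij: "bij_betw \<phi> U U"
    by (simp add: bij_betw_def endo_inj_surj image_subset_iff)
  have "pole_sum b a = (\<Sum>\<eta>\<in>U. chi (a * cj b / D) * chi (a / D * \<phi> \<eta>))"
    unfolding pole_sum_def
  proof (rule sum.cong[OF refl])
    fix \<eta> assume "\<eta> \<in> U"
    then have "a / (\<eta> + b) = a * cj b / D + a / D * \<phi> \<eta>"
      using \<phi>[of \<eta>] by (metis add_divide_distrib distrib_left mult.right_neutral times_divide_eq_left
          times_divide_eq_right)
    then show "chi (a / (\<eta> + b)) = chi (a * cj b / D) * chi (a / D * \<phi> \<eta>)"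
      by (simp only: chi_add)
  qed
  also have "\<dots> = chi (a * cj b / D) * (\<Sum>\<eta>\<in>U. chi (a / D * \<phi> \<eta>))"
    by (simp add: sum_distrib_left)
  also have "(\<Sum>\<eta>\<in>U. chi (a / D * \<phi> \<eta>)) = circle_sum (a / D)"
    unfolding circle_sum_def by (rule sum.reindex_bij_betw[OF bij])
  finally show ?thesis
    by (simp add: abs_mult D_def)
qed

text \<open>For a pole on the circle, \<open>\<eta> \<mapsto> b/(\<eta> + b)\<close> maps \<open>U - {b}\<close> onto the line \<open>w + cj w = 1\<close>.\<close>
lemma pole_sum_on_circle:
  assumes b: "b \<in> U"
  shows "pole_sum b a = 1 + q * (if a * cj b \<in> Fq then sgn2 (tr 1 n (a * cj b)) else 0)"
proof -
  obtain g where g: "g + cj g = 1"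
    using ex_trace_one by blast
  then have cjg: "cj g = g + 1"
    by (metis add_self_left)
  have b0: "b \<noteq> 0"
    using b by (metis zero_notin_U)
  have gF: "g + y \<noteq> 0" if "y \<in> Fq" for y
    using that g by (auto simp: add_eq_0_iff_eq mem_Fq_iff)
  \<comment> \<open>\<open>w = g + y\<close> runs over the elements of relative trace 1, and
    \<open>w = b / (\<eta> + b)\<close> solves to \<open>\<eta> = b + b / w\<close>.\<close>
  have bij: "bij_betw (\<lambda>y. b + b / (g + y)) Fq (U - {b})"
  proof (rule bij_betw_byWitness[where f' = "\<lambda>\<eta>. b / (\<eta> + b) + g"])
    show "\<forall>y\<in>Fq. b / (b + b / (g + y) + b) + g = y"
    proof
      fix y assume "y \<in> Fq"
      have "b + b / (g + y) + b = b / (g + y)"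
        by (simp add: add.commute)
      then show "b / (b + b / (g + y) + b) + g = y"
        using b0 by (simp add: add.commute)
    qed
    show "\<forall>\<eta>\<in>U - {b}. b + b / (g + (b / (\<eta> + b) + g)) = \<eta>"
    proof
      fix \<eta> assume "\<eta> \<in> U - {b}"
      have "g + (b / (\<eta> + b) + g) = b / (\<eta> + b)"
        by (simp add: add.left_commute two_eq_0)
      then show "b + b / (g + (b / (\<eta> + b) + g)) = \<eta>"
        using b0 by (simp only: divide_divide_eq_right nonzero_mult_div_cancel_left add.commute[of \<eta>]
            add_self_left not_False_eq_True)
    qed
    show "(\<lambda>y. b + b / (g + y)) ` Fq \<subseteq> U - {b}"
    proof
      fix x assume "x \<in> (\<lambda>y. b + b / (g + y)) ` Fq"
      then obtain y where y: "y \<in> Fq" "x = b + b / (g + y)" by blast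
      define w where "w = g + y"
      have w: "w \<noteq> 0" "cj w = w + 1"
        using gF[of y] y by (simp_all add: w_def cj_add cjg mem_Fq_iff)
      have "x = b * (cj w / w)"
        using w by (simp add: y w_def[symmetric] field_simps)
      moreover have "cj w / w \<in> U"
        using w(1) by (simp add: mem_U_iff cj_divide)
      ultimately have "x \<in> U"
        using b mult_in_U by blast
      moreover have "x \<noteq> b"
        using b0 w by (simp add: y w_def[symmetric])
      ultimately show "x \<in> U - {b}" by blast
    qed
    show "(\<lambda>\<eta>. b / (\<eta> + b) + g) ` (U - {b}) \<subseteq> Fq"
    proof (rule image_subsetI)
      fix \<eta> assume "\<eta> \<in> U - {b}"
      then have \<eta>: "\<eta> \<in> U" "\<eta> \<noteq> b"
        by auto
      have nz: "\<eta> \<noteq> 0" "\<eta> + b \<noteq> 0"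
        using \<eta> by (auto simp: add_eq_0_iff_eq)
      have "cj (b / (\<eta> + b)) = inverse b / (inverse \<eta> + inverse b)"
        using \<eta> b by (simp add: cj_divide cj_add cj_U)
      also have "\<dots> = \<eta> / (\<eta> + b)"
      proof -
        have "inverse \<eta> + inverse b = (\<eta> + b) / (\<eta> * b)"
          using nz b0 by (simp add: field_simps)
        then show ?thesis
          using nz b0 by (simp add: field_simps)
      qed
      also have "\<dots> = b / (\<eta> + b) + 1"
        using nz by (metis add.commute add_divide_distrib add_self_left divide_self)
      finally show "b / (\<eta> + b) + g \<in> Fq"
        by (simp add: mem_Fq_iff cj_add cjg add_ac)
    qed
  qed
  define c where "c = a * cj b"
  \<comment> \<open>The pole \<open>\<eta> = b\<close> contributes \<open>chi 0 = 1\<close>, by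
    \<open>a / 0 = 0\<close>.\<close>
  have "pole_sum b a = 1 + (\<Sum>\<eta>\<in>U - {b}. chi (a / (\<eta> + b)))"
    using b by (simp add: pole_sum_def sum.remove[of U b])
  also have "(\<Sum>\<eta>\<in>U - {b}. chi (a / (\<eta> + b))) = (\<Sum>y\<in>Fq. chi (a / (b + b / (g + y) + b)))"
    by (rule sum.reindex_bij_betw[OF bij, symmetric])
  also have "\<dots> = (\<Sum>y\<in>Fq. chi (c * g) * chi (c * y))"
  proof (rule sum.cong[OF refl])
    fix y assume y: "y \<in> Fq"
    have "b + b / (g + y) + b = b / (g + y)"
      by (simp add: add.commute)
    then have "a / (b + b / (g + y) + b) = c * g + c * y"
      unfolding c_def cj_U[OF b] using b0 by (simp add: field_simps)
    then show "chi (a / (b + b / (g + y) + b)) = chi (c * g) * chi (c * y)"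
      by (simp only: chi_add)
  qed
  also have "\<dots> = chi (c * g) * (if c \<in> Fq then q else 0)"
    by (simp only: sum_chi_Fq flip: sum_distrib_left)
  also have "\<dots> = q * (if c \<in> Fq then sgn2 (tr 1 n c) else 0)"
  proof (cases "c \<in> Fq")
    case True
    then have "c * g + cj (c * g) = c * (g + cj g)"
      by (simp add: cj_mult mem_Fq_iff distrib_left)
    then have "Tr (c * g) = tr 1 n c"
      by (simp only: Tr_eq_tr_n g mult_1_right)
    then show ?thesis
      using True by (simp only: chi_def if_True mult.commute)
  qed simp
  finally show ?thesis
    by (simp only: c_def)
qed

text \<open>The square of \<open>a * cj b\<close> is its norm, which is that of \<open>a\<close>,
  and squaring preserves the trace. This turns the values of \<open>pole_sum_on_circle\<close> into
  the norm conditions of the theorem.\<close>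

lemma tr_1_norm:
  assumes "b \<in> U" "a * cj b \<in> Fq"
  shows "tr 1 n (a * cj a) = tr 1 n (a * cj b)"
proof -
  have "(a * cj b) ^ 2 = a * cj b * cj (a * cj b)"
    using assms(2) by (simp add: mem_Fq_iff power2_eq_square)
  also have "\<dots> = a * cj a * (b * cj b)"
    by (simp add: cj_mult mult_ac)
  also have "\<dots> = a * cj a"
    using assms(1) by (simp add: mem_U_iff)
  finally show ?thesis
    using tr_1_square[of "a * cj b" n] assms(2) by (simp add: subfield_q_def)
qed

end

section \<open>The bentness criterion, by position of the pole\<close>

theorem theorem2:
  fixes n :: nat and a1 a2 b :: "'a::{field,finite}"
  assumes "n \<ge> 6"
    and "card (UNIV :: 'a set) = 2 ^ (2 * n)"
    and "a1 \<in> subfield_q n" and "a1 \<noteq> 0"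
    and "a2 \<noteq> 0" and "b \<noteq> 0" and "a1 \<noteq> a2"
  shows "bent (2 * n) (\<lambda>x. fi n a1 b x * fi n a2 b x) \<longleftrightarrow>
     ((b = 1 \<and> tr 1 n a1 = 1 \<and> a2 \<notin> subfield_q n)
    \<or> (b \<in> unit_circle n - {1} \<and> tr n (2 * n) (a2 * conj_q n b) = 0
        \<and> tr 1 n (a2 * conj_q n a2) = 1 \<and> fi n a1 b 0 * fi n a2 b 0 = 0)
    \<or> (b \<in> unit_circle n - {1} \<and> tr n (2 * n) ((a1 + a2) * conj_q n b) = 0
        \<and> tr 1 n ((a1 + a2) * (a1 + conj_q n a2)) = 0 \<and> fi n a1 b 0 * fi n a2 b 0 = 0))"
proof -
  interpret binary_quadratic_extension n "TYPE('a)"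
    using assms(1,2) by unfold_locales auto
  define g where "g \<eta> = Tr (a1 / (\<eta> + b)) * Tr (a2 / (\<eta> + b))" for \<eta>
  define S where "S = (\<Sum>\<eta>\<in>U. sgn2 (g \<eta>))"
  have g: "g x = 0 \<or> g x = 1" for x
    using Tr_cases[of "a1 / (x + b)"] Tr_cases[of "a2 / (x + b)"] unfolding g_def by force
  have f: "(\<lambda>x. fi n a1 b x * fi n a2 b x) = (\<lambda>x. g (x ^ (2 ^ n - 1)))"
    by (simp only: fi_def g_def)
  have g0: "fi n a1 b 0 * fi n a2 b 0 = g 0"
    using one_less_power[of "2 :: nat" n] n_pos by (simp add: fi_def g_def power_0_left)
  have bent: "bent (2 * n) (\<lambda>x. fi n a1 b x * fi n a2 b x) \<longleftrightarrow> S = sgn2 (g 0)"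
    unfolding f S_def using assms(1) by (intro bent_iff_sum_U g) auto
  have S: "2 * S = q + 1 + pole_sum b a1 + pole_sum b a2 - pole_sum b (a1 + a2)"
    unfolding S_def g_def by (rule sum_U_product)
  show ?thesis
  proof (cases "b \<in> U")
    case False
    have D: "1 + b * cj b \<noteq> 0"
      using False unfolding add_eq_0_iff_eq by (metis mem_U_iff)
    have "\<bar>pole_sum b a1\<bar> + \<bar>pole_sum b a2\<bar> + \<bar>pole_sum b (a1 + a2)\<bar> < q - 1"
      unfolding pole_sum_off_circle[OF False] add_divide_distrib
      using assms D by (intro circle_sum_triple_bound) auto
    then have "S > 1"
      using S by linarith
    then have "S \<noteq> sgn2 (g 0)"
      using sgn2_cases[of "g 0"] by auto
    moreover have "b \<noteq> 1"
      using False by auto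
    ultimately show ?thesis
      using False bent by blast
  next
    case True
    define e where "e a = (if a * cj b \<in> Fq then sgn2 (tr 1 n (a * cj b)) else 0)" for a
    have "2 * S - 2 = q * (1 + e a1 + e a2 - e (a1 + a2))"
      unfolding S pole_sum_on_circle[OF True] e_def[symmetric] by (simp add: algebra_simps)
    moreover have "q \<ge> 64"
      using power_increasing[of 6 n "2 :: int"] assms(1) by simp
    \<comment> \<open>\<open>S = -1\<close> would make the left side \<open>-4\<close>, so
      \<open>S = sgn2 (g 0)\<close> forces \<open>g 0 = 0\<close> and \<open>S = 1\<close>.\<close>
    then have "q * k \<noteq> -4" for k
      by (smt (verit) mult_le_cancel_left1 mult_minus_right mult_nonneg_nonneg zero_less_mult_iff)
    ultimately have S_iff: "S = sgn2 (g 0) \<longleftrightarrow> g 0 = 0 \<and> 1 + e a1 + e a2 = e (a1 + a2)"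
      using g[of 0] by (auto simp: sgn2_def)
    have e_cases: "e a = (if a * cj b \<in> Fq then if tr 1 n (a * cj a) = 0 then 1 else -1 else 0)"
      "a * cj b \<in> Fq \<Longrightarrow> tr 1 n (a * cj a) = 0 \<or> tr 1 n (a * cj a) = 1" for a
      using tr_1_norm[OF True, of a] tr_1_cases[of "a * cj b" n]
      by (auto simp: e_def sgn2_def subfield_q_def)
    have norm3: "(a1 + a2) * (a1 + cj a2) = (a1 + a2) * cj (a1 + a2)"
      using assms(3) by (simp add: cj_add mem_Fq_iff)
    show ?thesis
    proof (cases "b = 1")
      case b1: True
      have "g 0 = 0"
        using Tr_Fq[OF assms(3)] unfolding g_def by (simp add: b1)
      moreover have "1 + e a1 + e a2 = e (a1 + a2) \<longleftrightarrow> tr 1 n a1 = 1 \<and> a2 \<notin> Fq"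
      proof (cases "a2 \<in> Fq")
        case a2: True
        have "tr 1 n a1 = 0 \<or> tr 1 n a1 = 1" "tr 1 n a2 = 0 \<or> tr 1 n a2 = 1"
          using assms(3) a2 by (auto intro!: tr_1_cases simp: subfield_q_def simp del: One_nat_def)
        \<comment> \<open>The equation becomes \<open>(e a1 - 1) * (e a2 - 1) = 2\<close>,
          impossible for signs.\<close>
        then have "e (a1 + a2) = e a1 * e a2"
          using assms(3) a2 by (simp add: e_def b1 Fq_add tr_1_add sgn2_add del: One_nat_def)
        moreover have "e a1 = 1 \<or> e a1 = -1" "e a2 = 1 \<or> e a2 = -1"
          using assms(3) a2 sgn2_cases by (simp_all add: e_def b1)
        ultimately show ?thesis
          using a2 by auto
      next
        case a2: False
        \<comment> \<open>So \<open>e a2\<close> and \<open>e (a1 + a2)\<close> vanish, and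
          \<open>e a1 = -1\<close> remains.\<close>
        then have "a1 + a2 \<notin> Fq"
          using Fq_add[OF assms(3), of "a1 + a2"] by auto
        moreover have "tr 1 n a1 = 0 \<or> tr 1 n a1 = 1"
          using assms(3) by (auto intro!: tr_1_cases simp: subfield_q_def simp del: One_nat_def)
        ultimately show ?thesis
          using a2 assms(3) by (auto simp: e_def b1 sgn2_def)
      qed
      ultimately show ?thesis
        unfolding bent S_iff g0 by (simp add: b1)
    next
      case b1: False
      have "a1 * cj b \<notin> Fq"
      proof
        assume "a1 * cj b \<in> Fq"
        then have "cj b \<in> Fq"
          using Fq_divide[OF _ assms(3)] assms(4) by fastforce
        then have "b \<in> Fq"
          by (simp add: mem_Fq_iff)
        then show False
          using Fq_inter_U True b1 by blast
      qed
      \<comment> \<open>Hence \<open>e a1 = 0\<close>, and \<open>e a2\<close>,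
        \<open>e (a1 + a2)\<close> are not both nonzero. Then \<open>1 + e a2 = e (a1 + a2)\<close>
        means \<open>e a2 = -1\<close>, condition (2), or \<open>e (a1 + a2) = 1\<close>, condition
        (3).\<close>
      moreover have "a1 * cj b \<in> Fq" if "a2 * cj b \<in> Fq" "(a1 + a2) * cj b \<in> Fq"
        using Fq_add[OF that] by (simp add: distrib_right add.left_commute)
      ultimately show ?thesis
        unfolding bent S_iff g0 tr_n_eq_0_iff norm3
        using True b1 e_cases[of a1] e_cases[of a2] e_cases[of "a1 + a2"] by auto
    qed
  qed
qed

end
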